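(* Let $L:\mathbb{A}\to\mathbb{B}$, $R:\mathbb{B}\to\mathbb{A}$ be functors, $(L,R,\alpha,\beta)$ a regular pairing with $\beta$ symmetric (with associated $\eta:I_{\mathbb{A}}\to RL$, $\varepsilon:LR\to I_{\mathbb{B}}$, $\ell:L\to L$, $r:R\to R$), and $\tilde\varepsilon:RL\to I_{\mathbb{A}}$ any natural transformation. Then: (1) $\hat\varepsilon:=\tilde\varepsilon\cdot r\ell:RL\to I_{\mathbb{A}}$ is a natural transformation with $\hat\varepsilon=\hat\varepsilon\cdot r\ell$. Furthermore $\ell r\cdot L\hat\varepsilon R=L\hat\varepsilon R$, that is, $L\hat\varepsilon R$ is $\ell r$-compatible as an $LR$-comodule morphism. (2) $(LR,L\eta R,\varepsilon)$ is a weak comonad, and if $\omega:B\to LR(B)$ is an $\ell r$-compatible $LR$-comodule, there is a unique $\ell r$-compatible comodule morphism $\varrho:LR(B)\to B$ making $(B,\varrho,\omega)$ a Frobenius $(LR,\eta,\hat\varepsilon)$-bimodule, given by $$\varrho:\ LR(B)\xrightarrow{LR(\omega)}LRLR(B)\xrightarrow{L\hat\varepsilon_{R(B)}}LR(B)\xrightarrow{\varepsilon_B}B.$$ (3) $LR$-comodule morphisms between $\ell r$-compatible $LR$-comodules $(B,\omega)$, $(B',\omega')$ are $LR$-bimodule morphisms between $(B,\varrho,\omega)$ and $(B',\varrho',\omega')$, where $\varrho,\varrho'$ are the morphisms given in (2).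
   Context: A pairing $(L,R,\alpha,\beta)$ consists of maps $\alpha:\mathrm{Mor}_{\mathbb{B}}(L(A),B)\to\mathrm{Mor}_{\mathbb{A}}(A,R(B))$ and $\beta$ in the opposite direction, natural in $A\in\mathbb{A}$, $B\in\mathbb{B}$. It determines (and is determined by) natural transformations $\eta:I_{\mathbb{A}}\to RL$ ($\eta_A=\alpha(I_{L(A)})$) and $\varepsilon:LR\to I_{\mathbb{B}}$ ($\varepsilon_B=\beta(I_{R(B)})$). Put $\ell:=\varepsilon L\cdot L\eta:L\to L$ and $r:=R\varepsilon\cdot\eta R:R\to R$. The pairing is regular if $\alpha\beta\alpha=\alpha$ and $\beta\alpha\beta=\beta$. $\beta$ is symmetric if $Lr=\ell R$. $\ell r:LR\to LR$ and $r\ell:RL\to RL$ denote horizontal composites. A weak comonad $(G,\delta,\varepsilon)$ is an endofunctor $G$ with coassociative $\delta:G\to GG$ and a natural $\varepsilon:G\to I$ such that $\varepsilon=\varepsilon\cdot G\varepsilon\cdot\delta$, $\delta=G\varepsilon G\cdot G\delta\cdot\delta$, $G\varepsilon\cdot\delta=\varepsilon G\cdot\delta$. $LR$-comodules are non-counital comodules for $(LR,L\eta R)$: pairs $(B,\omega)$, $\omega:B\to LR(B)$, with $LR(\omega)\cdot\omega=L\eta_{R(B)}\cdot\omega$. $LR(B)$ is a comodule via $L\eta_{R(B)}$. $(B,\omega)$ is $\ell r$-compatible if $(\ell r)_B\cdot\omega=\omega$. A comodule morphism $h:(B,\omega)\to(B',\omega')$ is $\ell r$-compatible if $h\cdot\varepsilon_B\cdot\omega=h$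 (equivalently $\varepsilon_{B'}\cdot\omega'\cdot h=h$); a comodule morphism $h:Q\to LR(B)$ is $\ell r$-compatible iff $(\ell r)_B\cdot h=h$. For $\eta:I_{\mathbb{A}}\to RL$ and $\hat\varepsilon:RL\to I_{\mathbb{A}}$, a Frobenius $(LR,\eta,\hat\varepsilon)$-bimodule is a triple $(B,\varrho,\omega)$ with $(B,\varrho)$ a non-unital module over $(LR,L\hat\varepsilon R)$ (i.e. $\varrho\cdot LR(\varrho)=\varrho\cdot L\hat\varepsilon_{R(B)}$), $(B,\omega)$ a non-counital $(LR,L\eta R)$-comodule, and $LR(\varrho)\cdot L\eta_{R(B)}=\omega\cdot\varrho=L\hat\varepsilon_{R(B)}\cdot LR(\omega)$. Bimodule morphisms are morphisms in $\mathbb{B}$ that are both module and comodule morphisms. *)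

theory Defs
  imports Main "HOL-Library.FuncSet"
begin

section \<open>Categories, functors and natural transformations\<close>

record ('o, 'm) cat =
  Obj :: "'o set"
  Mor :: "'m set"
  Dom :: "'m \<Rightarrow> 'o"
  Cod :: "'m \<Rightarrow> 'o"
  Id :: "'o \<Rightarrow> 'm"
  Comp :: "'m \<Rightarrow> 'm \<Rightarrow> 'm"  (infixl "\<cdot>\<index>" 70)

definition hom :: "('o, 'm) cat \<Rightarrow> 'o \<Rightarrow> 'o \<Rightarrow> 'm set" where
  "hom C X Y = {f \<in> Mor C. Dom C f = X \<and> Cod C f = Y}"

locale category =
  fixes C :: "('o, 'm) cat" (structure)
  assumes Dom_Obj: "f \<in> Mor C \<Longrightarrow> Dom C f \<in> Obj C"
    and Cod_Obj: "f \<in> Mor C \<Longrightarrow> Cod C f \<in> Obj C"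
    and Id_hom: "X \<in> Obj C \<Longrightarrow> Id C X \<in> hom C X X"
    and Comp_hom: "\<lbrakk>f \<in> hom C X Y; g \<in> hom C Y Z\<rbrakk> \<Longrightarrow> g \<cdot> f \<in> hom C X Z"
    and Comp_assoc: "\<lbrakk>f \<in> hom C X Y; g \<in> hom C Y Z; h \<in> hom C Z W\<rbrakk>
      \<Longrightarrow> (h \<cdot> g) \<cdot> f = h \<cdot> (g \<cdot> f)"
    and Id_left: "f \<in> hom C X Y \<Longrightarrow> Id C Y \<cdot> f = f"
    and Id_right: "f \<in> hom C X Y \<Longrightarrow> f \<cdot> Id C X = f"

record ('o1, 'm1, 'o2, 'm2) func =
  FObj :: "'o1 \<Rightarrow> 'o2"
  FMor :: "'m1 \<Rightarrow> 'm2"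

locale cat_functor = dom: category C + cod: category D
  for C :: "('o1, 'm1) cat" and D :: "('o2, 'm2) cat" +
  fixes F :: "('o1, 'm1, 'o2, 'm2) func"
  assumes FObj_Obj: "X \<in> Obj C \<Longrightarrow> FObj F X \<in> Obj D"
    and FMor_hom: "f \<in> hom C X Y \<Longrightarrow> FMor F f \<in> hom D (FObj F X) (FObj F Y)"
    and FMor_Id: "X \<in> Obj C \<Longrightarrow> FMor F (Id C X) = Id D (FObj F X)"
    and FMor_Comp: "\<lbrakk>f \<in> hom C X Y; g \<in> hom C Y Z\<rbrakk>
      \<Longrightarrow> FMor F (g \<cdot>\<^bsub>C\<^esub> f) = FMor F g \<cdot>\<^bsub>D\<^esub> FMor F f"

definition fid :: "('o, 'm, 'o, 'm) func" where
  "fid = \<lparr>FObj = (\<lambda>X. X), FMor = (\<lambda>f. f)\<rparr>"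

definition fcomp :: "('o2, 'm2, 'o3, 'm3) func \<Rightarrow> ('o1, 'm1, 'o2, 'm2) func
    \<Rightarrow> ('o1, 'm1, 'o3, 'm3) func"  (infixr "\<circ>\<^sub>F" 75) where
  "G \<circ>\<^sub>F F = \<lparr>FObj = (\<lambda>X. FObj G (FObj F X)), FMor = (\<lambda>f. FMor G (FMor F f))\<rparr>"

text \<open>A natural transformation is its family of components; only the components at objects
  of the source category matter, so equality of transformations is \<open>nt_eq\<close> below.\<close>

locale nat_trans = F: cat_functor C D F + G: cat_functor C D G
  for C :: "('o1, 'm1) cat" and D :: "('o2, 'm2) cat" and F G +
  fixes \<tau> :: "'o1 \<Rightarrow> 'm2"
  assumes component_hom: "X \<in> Obj C \<Longrightarrow> \<tau> X \<in> hom D (FObj F X) (FObj G X)"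
    and naturality: "f \<in> hom C X Y
      \<Longrightarrow> \<tau> Y \<cdot>\<^bsub>D\<^esub> FMor F f = FMor G f \<cdot>\<^bsub>D\<^esub> \<tau> X"

definition nt_eq :: "('o, 'm) cat \<Rightarrow> ('o \<Rightarrow> 'n) \<Rightarrow> ('o \<Rightarrow> 'n) \<Rightarrow> bool" where
  "nt_eq C \<sigma> \<tau> \<longleftrightarrow> (\<forall>X\<in>Obj C. \<sigma> X = \<tau> X)"

definition vcomp :: "('o2, 'm2) cat \<Rightarrow> ('o1 \<Rightarrow> 'm2) \<Rightarrow> ('o1 \<Rightarrow> 'm2) \<Rightarrow> ('o1 \<Rightarrow> 'm2)" where
  "vcomp D \<sigma> \<tau> = (\<lambda>X. \<sigma> X \<cdot>\<^bsub>D\<^esub> \<tau> X)"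

text \<open>The whiskerings \<open>F\<tau>\<close> and \<open>\<tau>F\<close>.\<close>

definition whisker_left :: "('o2, 'm2, 'o3, 'm3) func \<Rightarrow> ('o1 \<Rightarrow> 'm2) \<Rightarrow> ('o1 \<Rightarrow> 'm3)"
    (infixr "\<rhd>" 75) where
  "F \<rhd> \<tau> = (\<lambda>X. FMor F (\<tau> X))"

definition whisker_right :: "('o2 \<Rightarrow> 'm3) \<Rightarrow> ('o1, 'm1, 'o2, 'm2) func \<Rightarrow> ('o1 \<Rightarrow> 'm3)"
    (infixl "\<lhd>" 76) where
  "\<tau> \<lhd> F = (\<lambda>X. \<tau> (FObj F X))"

text \<open>The horizontal composite \<open>\<sigma>\<tau> = \<sigma>G \<cdot> H\<tau>\<close> of \<open>\<sigma> : H \<rightarrow> K\<close> and \<open>\<tau> : F \<rightarrow> G\<close>.\<close>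

definition hcomp :: "('o3, 'm3) cat \<Rightarrow> ('o2, 'm2, 'o3, 'm3) func \<Rightarrow> ('o2 \<Rightarrow> 'm3)
    \<Rightarrow> ('o1, 'm1, 'o2, 'm2) func \<Rightarrow> ('o1 \<Rightarrow> 'm2) \<Rightarrow> ('o1 \<Rightarrow> 'm3)" where
  "hcomp D H \<sigma> G \<tau> = vcomp D (\<sigma> \<lhd> G) (H \<rhd> \<tau>)"

section \<open>Pairings of functors\<close>

locale pairing = L: cat_functor A B L + R: cat_functor B A R
  for A :: "('oa, 'ma) cat" and B :: "('ob, 'mb) cat" and L R +
  fixes \<alpha> :: "'oa \<Rightarrow> 'ob \<Rightarrow> 'mb \<Rightarrow> 'ma" and \<beta> :: "'oa \<Rightarrow> 'ob \<Rightarrow> 'ma \<Rightarrow> 'mb"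
  assumes \<alpha>_hom: "\<lbrakk>X \<in> Obj A; Y \<in> Obj B\<rbrakk>
      \<Longrightarrow> \<alpha> X Y \<in> hom B (FObj L X) Y \<rightarrow> hom A X (FObj R Y)"
    and \<beta>_hom: "\<lbrakk>X \<in> Obj A; Y \<in> Obj B\<rbrakk>
      \<Longrightarrow> \<beta> X Y \<in> hom A X (FObj R Y) \<rightarrow> hom B (FObj L X) Y"
    and \<alpha>_natural: "\<lbrakk>a \<in> hom A X' X; b \<in> hom B Y Y'; f \<in> hom B (FObj L X) Y\<rbrakk>
      \<Longrightarrow> \<alpha> X' Y' (b \<cdot>\<^bsub>B\<^esub> f \<cdot>\<^bsub>B\<^esub> FMor L a) = FMor R b \<cdot>\<^bsub>A\<^esub> \<alpha> X Y f \<cdot>\<^bsub>A\<^esub> a"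
    and \<beta>_natural: "\<lbrakk>a \<in> hom A X' X; b \<in> hom B Y Y'; g \<in> hom A X (FObj R Y)\<rbrakk>
      \<Longrightarrow> \<beta> X' Y' (FMor R b \<cdot>\<^bsub>A\<^esub> g \<cdot>\<^bsub>A\<^esub> a) = b \<cdot>\<^bsub>B\<^esub> \<beta> X Y g \<cdot>\<^bsub>B\<^esub> FMor L a"

locale regular_pairing = pairing +
  assumes \<alpha>\<beta>\<alpha>: "\<lbrakk>X \<in> Obj A; Y \<in> Obj B; f \<in> hom B (FObj L X) Y\<rbrakk>
      \<Longrightarrow> \<alpha> X Y (\<beta> X Y (\<alpha> X Y f)) = \<alpha> X Y f"
    and \<beta>\<alpha>\<beta>: "\<lbrakk>X \<in> Obj A; Y \<in> Obj B; g \<in> hom A X (FObj R Y)\<rbrakk>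
      \<Longrightarrow> \<beta> X Y (\<alpha> X Y (\<beta> X Y g)) = \<beta> X Y g"

definition pairing_unit :: "('ob, 'mb) cat \<Rightarrow> ('oa, 'ma, 'ob, 'mb) func
    \<Rightarrow> ('oa \<Rightarrow> 'ob \<Rightarrow> 'mb \<Rightarrow> 'ma) \<Rightarrow> ('oa \<Rightarrow> 'ma)" where
  "pairing_unit B L \<alpha> = (\<lambda>X. \<alpha> X (FObj L X) (Id B (FObj L X)))"

definition pairing_counit :: "('oa, 'ma) cat \<Rightarrow> ('ob, 'mb, 'oa, 'ma) func
    \<Rightarrow> ('oa \<Rightarrow> 'ob \<Rightarrow> 'ma \<Rightarrow> 'mb) \<Rightarrow> ('ob \<Rightarrow> 'mb)" where
  "pairing_counit A R \<beta> = (\<lambda>Y. \<beta> (FObj R Y) Y (Id A (FObj R Y)))"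

definition pairing_ell :: "('ob, 'mb) cat \<Rightarrow> ('oa, 'ma, 'ob, 'mb) func
    \<Rightarrow> ('oa \<Rightarrow> 'ma) \<Rightarrow> ('ob \<Rightarrow> 'mb) \<Rightarrow> ('oa \<Rightarrow> 'mb)" where
  "pairing_ell B L \<eta> \<epsilon> = vcomp B (\<epsilon> \<lhd> L) (L \<rhd> \<eta>)"

definition pairing_r :: "('oa, 'ma) cat \<Rightarrow> ('ob, 'mb, 'oa, 'ma) func
    \<Rightarrow> ('oa \<Rightarrow> 'ma) \<Rightarrow> ('ob \<Rightarrow> 'mb) \<Rightarrow> ('ob \<Rightarrow> 'ma)" where
  "pairing_r A R \<eta> \<epsilon> = vcomp A (R \<rhd> \<epsilon>) (\<eta> \<lhd> R)"

definition symmetric_pairing :: "('oa, 'ma) cat \<Rightarrow> ('ob, 'mb) cat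
    \<Rightarrow> ('oa, 'ma, 'ob, 'mb) func \<Rightarrow> ('ob, 'mb, 'oa, 'ma) func
    \<Rightarrow> ('oa \<Rightarrow> 'ob \<Rightarrow> 'mb \<Rightarrow> 'ma) \<Rightarrow> ('oa \<Rightarrow> 'ob \<Rightarrow> 'ma \<Rightarrow> 'mb) \<Rightarrow> bool" where
  "symmetric_pairing A B L R \<alpha> \<beta> \<longleftrightarrow>
    (let \<eta> = pairing_unit B L \<alpha>; \<epsilon> = pairing_counit A R \<beta>
     in nt_eq B (L \<rhd> pairing_r A R \<eta> \<epsilon>) (pairing_ell B L \<eta> \<epsilon> \<lhd> R))"

section \<open>Weak comonads, modules and comodules\<close>

locale weak_comonad = category C + \<delta>: nat_trans C C G "G \<circ>\<^sub>F G" \<delta> + \<epsilon>: nat_trans C C G fid \<epsilon>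
  for C :: "('o, 'm) cat" and G \<delta> \<epsilon> +
  assumes coassoc: "nt_eq C (vcomp C (G \<rhd> \<delta>) \<delta>) (vcomp C (\<delta> \<lhd> G) \<delta>)"
    and weak_counit: "nt_eq C \<epsilon> (vcomp C \<epsilon> (vcomp C (G \<rhd> \<epsilon>) \<delta>))"
    and weak_comult: "nt_eq C \<delta> (vcomp C (G \<rhd> (\<epsilon> \<lhd> G)) (vcomp C (G \<rhd> \<delta>) \<delta>))"
    and counit_symmetric: "nt_eq C (vcomp C (G \<rhd> \<epsilon>) \<delta>) (vcomp C (\<epsilon> \<lhd> G) \<delta>)"

text \<open>Comodules are for \<open>(G, \<delta> : G \<rightarrow> GG)\<close>, modules for \<open>(G, \<mu> : GG \<rightarrow> G)\<close>.\<close>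

definition noncounital_comodule :: "('o, 'm) cat \<Rightarrow> ('o, 'm, 'o, 'm) func \<Rightarrow> ('o \<Rightarrow> 'm)
    \<Rightarrow> 'o \<Rightarrow> 'm \<Rightarrow> bool" where
  "noncounital_comodule C G \<delta> Y \<omega> \<longleftrightarrow> Y \<in> Obj C \<and> \<omega> \<in> hom C Y (FObj G Y) \<and>
    FMor G \<omega> \<cdot>\<^bsub>C\<^esub> \<omega> = \<delta> Y \<cdot>\<^bsub>C\<^esub> \<omega>"

definition comodule_mor :: "('o, 'm) cat \<Rightarrow> ('o, 'm, 'o, 'm) func \<Rightarrow> ('o \<Rightarrow> 'm)
    \<Rightarrow> 'o \<Rightarrow> 'm \<Rightarrow> 'o \<Rightarrow> 'm \<Rightarrow> 'm \<Rightarrow> bool" where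
  "comodule_mor C G \<delta> Y \<omega> Y' \<omega>' h \<longleftrightarrow> noncounital_comodule C G \<delta> Y \<omega> \<and> noncounital_comodule C G \<delta> Y' \<omega>' \<and>
    h \<in> hom C Y Y' \<and> \<omega>' \<cdot>\<^bsub>C\<^esub> h = FMor G h \<cdot>\<^bsub>C\<^esub> \<omega>"

definition nonunital_module :: "('o, 'm) cat \<Rightarrow> ('o, 'm, 'o, 'm) func \<Rightarrow> ('o \<Rightarrow> 'm)
    \<Rightarrow> 'o \<Rightarrow> 'm \<Rightarrow> bool" where
  "nonunital_module C G \<mu> Y \<rho> \<longleftrightarrow> Y \<in> Obj C \<and> \<rho> \<in> hom C (FObj G Y) Y \<and>
    \<rho> \<cdot>\<^bsub>C\<^esub> FMor G \<rho> = \<rho> \<cdot>\<^bsub>C\<^esub> \<mu> Y"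

definition module_mor :: "('o, 'm) cat \<Rightarrow> ('o, 'm, 'o, 'm) func \<Rightarrow> ('o \<Rightarrow> 'm)
    \<Rightarrow> 'o \<Rightarrow> 'm \<Rightarrow> 'o \<Rightarrow> 'm \<Rightarrow> 'm \<Rightarrow> bool" where
  "module_mor C G \<mu> Y \<rho> Y' \<rho>' h \<longleftrightarrow> nonunital_module C G \<mu> Y \<rho> \<and> nonunital_module C G \<mu> Y' \<rho>' \<and>
    h \<in> hom C Y Y' \<and> h \<cdot>\<^bsub>C\<^esub> \<rho> = \<rho>' \<cdot>\<^bsub>C\<^esub> FMor G h"

text \<open>In the two compatibility notions, \<open>\<kappa> : G \<rightarrow> G\<close> is to be instantiated with the horizontal composite \<open>lr\<close>,
  and \<open>\<epsilon> : G \<rightarrow> I\<close> with the counit of the pairing.\<close>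

definition compatible_comodule :: "('o, 'm) cat \<Rightarrow> ('o, 'm, 'o, 'm) func \<Rightarrow> ('o \<Rightarrow> 'm)
    \<Rightarrow> ('o \<Rightarrow> 'm) \<Rightarrow> 'o \<Rightarrow> 'm \<Rightarrow> bool" where
  "compatible_comodule C G \<delta> \<kappa> Y \<omega> \<longleftrightarrow> noncounital_comodule C G \<delta> Y \<omega> \<and> \<kappa> Y \<cdot>\<^bsub>C\<^esub> \<omega> = \<omega>"

definition compatible_comodule_mor :: "('o, 'm) cat \<Rightarrow> ('o, 'm, 'o, 'm) func \<Rightarrow> ('o \<Rightarrow> 'm)
    \<Rightarrow> ('o \<Rightarrow> 'm) \<Rightarrow> 'o \<Rightarrow> 'm \<Rightarrow> 'o \<Rightarrow> 'm \<Rightarrow> 'm \<Rightarrow> bool" where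
  "compatible_comodule_mor C G \<delta> \<epsilon> Y \<omega> Y' \<omega>' h \<longleftrightarrow>
    comodule_mor C G \<delta> Y \<omega> Y' \<omega>' h \<and> h \<cdot>\<^bsub>C\<^esub> \<epsilon> Y \<cdot>\<^bsub>C\<^esub> \<omega> = h"

section \<open>Frobenius bimodules\<close>

definition frobenius_bimodule :: "('ob, 'mb) cat \<Rightarrow> ('oa, 'ma, 'ob, 'mb) func
    \<Rightarrow> ('ob, 'mb, 'oa, 'ma) func \<Rightarrow> ('oa \<Rightarrow> 'ma) \<Rightarrow> ('oa \<Rightarrow> 'ma)
    \<Rightarrow> 'ob \<Rightarrow> 'mb \<Rightarrow> 'mb \<Rightarrow> bool" where
  "frobenius_bimodule B L R \<eta> \<epsilon>h Y \<rho> \<omega> \<longleftrightarrow>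
    nonunital_module B (L \<circ>\<^sub>F R) (L \<rhd> \<epsilon>h \<lhd> R) Y \<rho> \<and>
    noncounital_comodule B (L \<circ>\<^sub>F R) (L \<rhd> \<eta> \<lhd> R) Y \<omega> \<and>
    FMor (L \<circ>\<^sub>F R) \<rho> \<cdot>\<^bsub>B\<^esub> FMor L (\<eta> (FObj R Y)) = \<omega> \<cdot>\<^bsub>B\<^esub> \<rho> \<and>
    \<omega> \<cdot>\<^bsub>B\<^esub> \<rho> = FMor L (\<epsilon>h (FObj R Y)) \<cdot>\<^bsub>B\<^esub> FMor (L \<circ>\<^sub>F R) \<omega>"

definition frobenius_bimodule_mor :: "('ob, 'mb) cat \<Rightarrow> ('oa, 'ma, 'ob, 'mb) func
    \<Rightarrow> ('ob, 'mb, 'oa, 'ma) func \<Rightarrow> ('oa \<Rightarrow> 'ma) \<Rightarrow> ('oa \<Rightarrow> 'ma)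
    \<Rightarrow> 'ob \<Rightarrow> 'mb \<Rightarrow> 'mb \<Rightarrow> 'ob \<Rightarrow> 'mb \<Rightarrow> 'mb \<Rightarrow> 'mb \<Rightarrow> bool" where
  "frobenius_bimodule_mor B L R \<eta> \<epsilon>h Y \<rho> \<omega> Y' \<rho>' \<omega>' h \<longleftrightarrow>
    frobenius_bimodule B L R \<eta> \<epsilon>h Y \<rho> \<omega> \<and> frobenius_bimodule B L R \<eta> \<epsilon>h Y' \<rho>' \<omega>' \<and>
    module_mor B (L \<circ>\<^sub>F R) (L \<rhd> \<epsilon>h \<lhd> R) Y \<rho> Y' \<rho>' h \<and>
    comodule_mor B (L \<circ>\<^sub>F R) (L \<rhd> \<eta> \<lhd> R) Y \<omega> Y' \<omega>' h"

definition frobenius_action :: "('ob, 'mb) cat \<Rightarrow> ('oa, 'ma, 'ob, 'mb) func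
    \<Rightarrow> ('ob, 'mb, 'oa, 'ma) func \<Rightarrow> ('ob \<Rightarrow> 'mb) \<Rightarrow> ('oa \<Rightarrow> 'ma) \<Rightarrow> 'ob \<Rightarrow> 'mb \<Rightarrow> 'mb" where
  "frobenius_action B L R \<epsilon> \<epsilon>h Y \<omega> =
    \<epsilon> Y \<cdot>\<^bsub>B\<^esub> FMor L (\<epsilon>h (FObj R Y)) \<cdot>\<^bsub>B\<^esub> FMor (L \<circ>\<^sub>F R) \<omega>"

end

theory Submission
  imports Defs
begin

text \<open>
  Regularity amounts to \<open>\<epsilon> \<cdot> Lr = \<epsilon>\<close> and \<open>R\<ell> \<cdot> \<eta> = \<eta>\<close>, so \<open>\<ell>\<close> and \<open>r\<close> are idempotent, and by
  symmetry \<open>\<ell>r = Lr = \<ell>R\<close>. Hence \<open>r \<cdot> \<epsilon>\<^sub>hR = \<epsilon>\<^sub>hR\<close> for the corrected transformation \<open>\<epsilon>\<^sub>h = \<epsilon>\<^sub>t \<cdot> r\<ell>\<close>.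
  For a compatible comodule \<open>(Y, \<omega>)\<close> put \<open>x = \<epsilon>\<^sub>h\<^sub>R\<^sub>Y \<cdot> R\<omega> : RY \<rightarrow> RY\<close>; then \<open>r \<cdot> x = x\<close> and the action is
  \<open>\<rho> = \<epsilon>\<^sub>Y \<cdot> Lx\<close>. Naturality gives \<open>\<omega> \<cdot> \<rho> = Lx\<close>, from which every Frobenius identity follows.
  Uniqueness holds since a compatible \<open>\<rho>\<close> satisfies \<open>\<rho> = \<epsilon>\<^sub>Y \<cdot> \<omega> \<cdot> \<rho>\<close>, while \<open>\<omega> \<cdot> \<rho>\<close> is prescribed.
\<close>

section \<open>Typing and naturality rules\<close>

context category
begin

lemma homD:
  assumes "f \<in> hom C X Y"
  shows "f \<in> Mor C" "Dom C f = X" "Cod C f = Y" "X \<in> Obj C" "Y \<in> Obj C"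
  using assms Dom_Obj Cod_Obj by (auto simp: hom_def)

lemma homI: "\<lbrakk>f \<in> Mor C; Dom C f = X; Cod C f = Y\<rbrakk> \<Longrightarrow> f \<in> hom C X Y"
  by (simp add: hom_def)

text \<open>Here and below, hom-set membership is split into \<open>Mor\<close>, \<open>Dom\<close>
  and \<open>Cod\<close> facts, so that typing conditions are discharged by rewriting.\<close>

lemma Id_typing [simp]:
  assumes "X \<in> Obj C"
  shows "Id C X \<in> Mor C" "Dom C (Id C X) = X" "Cod C (Id C X) = X"
  using homD[OF Id_hom[OF assms]] by auto

lemma Comp_typing [simp]:
  assumes "f \<in> Mor C" "g \<in> Mor C" "Dom C g = Cod C f"
  shows "g \<cdot> f \<in> Mor C" "Dom C (g \<cdot> f) = Dom C f" "Cod C (g \<cdot> f) = Cod C g"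
  using homD[OF Comp_hom[of f "Dom C f" "Cod C f" g "Cod C g"]] assms by (auto simp: homI)

lemma Comp_assoc_Mor [simp]:
  assumes "f \<in> Mor C" "g \<in> Mor C" "h \<in> Mor C" "Dom C g = Cod C f" "Dom C h = Cod C g"
  shows "(h \<cdot> g) \<cdot> f = h \<cdot> (g \<cdot> f)"
  using assms by (intro Comp_assoc) (auto intro: homI)

lemma Id_unit [simp]:
  assumes "f \<in> Mor C"
  shows "Cod C f = Y \<Longrightarrow> Id C Y \<cdot> f = f" "Dom C f = X \<Longrightarrow> f \<cdot> Id C X = f"
  using assms by (auto intro: Id_left Id_right homI)

text \<open>Composites are normalised to right-nested form, which hides \<open>g \<cdot> f\<close>
  inside \<open>g \<cdot> (f \<cdot> z)\<close>; this version of an equation with a tail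
  \<open>z\<close> applies there.\<close>

lemma Comp_extend:
  assumes "g \<cdot> f = k" "f \<in> Mor C" "g \<in> Mor C" "Dom C g = Cod C f" "z \<in> Mor C" "Cod C z = Dom C f"
  shows "g \<cdot> (f \<cdot> z) = k \<cdot> z"
  using assms by auto

end

context cat_functor
begin

lemma FMor_typing [simp]:
  assumes "f \<in> Mor C"
  shows "FMor F f \<in> Mor D" "Dom D (FMor F f) = FObj F (Dom C f)"
    "Cod D (FMor F f) = FObj F (Cod C f)"
  using cod.homD[OF FMor_hom[OF dom.homI[OF assms]]] by auto

lemma FMor_Comp_Mor [simp]:
  assumes "f \<in> Mor C" "g \<in> Mor C" "Dom C g = Cod C f"
  shows "FMor F (g \<cdot>\<^bsub>C\<^esub> f) = FMor F g \<cdot>\<^bsub>D\<^esub> FMor F f"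
  using assms by (intro FMor_Comp) (auto intro: dom.homI)

lemmas F_Obj [simp] = FObj_Obj

end

context nat_trans
begin

lemma component_typing [simp]:
  assumes "X \<in> Obj C"
  shows "\<tau> X \<in> Mor D" "Dom D (\<tau> X) = FObj F X" "Cod D (\<tau> X) = FObj G X"
  using F.cod.homD[OF component_hom[OF assms]] by auto

lemma naturality_Mor:
  assumes "f \<in> Mor C" "Dom C f = X" "Cod C f = Y"
  shows "\<tau> Y \<cdot>\<^bsub>D\<^esub> FMor F f = FMor G f \<cdot>\<^bsub>D\<^esub> \<tau> X"
  using assms by (intro naturality) (auto intro: F.dom.homI)

end

section \<open>Composition of functors, and composites and whiskerings of natural
  transformations\<close>

lemma fcomp_simps [simp]:
  "FObj (G \<circ>\<^sub>F F) X = FObj G (FObj F X)" "FMor (G \<circ>\<^sub>F F) f = FMor G (FMor F f)"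
  by (simp_all add: fcomp_def)

lemma fid_simps [simp]: "FObj fid X = X" "FMor fid f = f"
  by (simp_all add: fid_def)

text \<open>Unit and associativity laws for functor composition are equalities of records, so
  sources and targets of whiskered transformations match without coherence isomorphisms.\<close>

lemma fcomp_fid [simp]: "F \<circ>\<^sub>F fid = F" "fid \<circ>\<^sub>F F = F"
  by (simp_all add: fcomp_def)

lemma fcomp_assoc [simp]: "(H \<circ>\<^sub>F G) \<circ>\<^sub>F F = H \<circ>\<^sub>F G \<circ>\<^sub>F F"
  by (simp add: fcomp_def)

lemma cat_functor_fid: "category C \<Longrightarrow> cat_functor C C fid"
  by (simp add: cat_functor_def cat_functor_axioms_def)

lemma cat_functor_fcomp:
  assumes "cat_functor C D F" "cat_functor D E G"
  shows "cat_functor C E (G \<circ>\<^sub>F F)"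
proof -
  interpret F: cat_functor C D F by fact
  interpret G: cat_functor D E G by fact
  show ?thesis
  proof unfold_locales
    fix f X Y assume "f \<in> hom C X Y"
    then show "FMor (G \<circ>\<^sub>F F) f \<in> hom E (FObj (G \<circ>\<^sub>F F) X) (FObj (G \<circ>\<^sub>F F) Y)"
      by (simp add: F.FMor_hom G.FMor_hom)
  next
    fix f g X Y Z assume "f \<in> hom C X Y" "g \<in> hom C Y Z"
    then show "FMor (G \<circ>\<^sub>F F) (g \<cdot>\<^bsub>C\<^esub> f) = FMor (G \<circ>\<^sub>F F) g \<cdot>\<^bsub>E\<^esub> FMor (G \<circ>\<^sub>F F) f"
      using F.dom.homD[of f X Y] F.dom.homD[of g Y Z] by simp
  qed (simp_all add: F.FMor_Id G.FMor_Id)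
qed

lemma nat_trans_vcomp:
  assumes "nat_trans C D F G \<tau>" "nat_trans C D G H \<sigma>"
  shows "nat_trans C D F H (vcomp D \<sigma> \<tau>)"
proof -
  interpret \<tau>: nat_trans C D F G \<tau> by fact
  interpret \<sigma>: nat_trans C D G H \<sigma> by fact
  show ?thesis
  proof unfold_locales
    fix X assume "X \<in> Obj C"
    then show "vcomp D \<sigma> \<tau> X \<in> hom D (FObj F X) (FObj H X)"
      by (auto simp: vcomp_def intro: \<tau>.F.cod.homI)
  next
    fix f X Y assume "f \<in> hom C X Y"
    then have f: "f \<in> Mor C" "Dom C f = X" "Cod C f = Y" "X \<in> Obj C" "Y \<in> Obj C"
      by (auto dest: \<tau>.F.dom.homD)
    have "(\<sigma> Y \<cdot>\<^bsub>D\<^esub> \<tau> Y) \<cdot>\<^bsub>D\<^esub> FMor F f = (\<sigma> Y \<cdot>\<^bsub>D\<^esub> FMor G f) \<cdot>\<^bsub>D\<^esub> \<tau> X"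
      using f by (simp add: \<tau>.naturality_Mor)
    then show "vcomp D \<sigma> \<tau> Y \<cdot>\<^bsub>D\<^esub> FMor F f = FMor H f \<cdot>\<^bsub>D\<^esub> vcomp D \<sigma> \<tau> X"
      using f by (simp add: vcomp_def \<sigma>.naturality_Mor)
  qed
qed

lemma nat_trans_whisker_left:
  assumes "nat_trans C D F G \<tau>" "cat_functor D E H"
  shows "nat_trans C E (H \<circ>\<^sub>F F) (H \<circ>\<^sub>F G) (H \<rhd> \<tau>)"
proof -
  interpret \<tau>: nat_trans C D F G \<tau> by fact
  interpret H: cat_functor D E H by fact
  interpret HF: cat_functor C E "H \<circ>\<^sub>F F" by (rule cat_functor_fcomp) unfold_locales
  interpret HG: cat_functor C E "H \<circ>\<^sub>F G" by (rule cat_functor_fcomp) unfold_locales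
  show ?thesis
  proof unfold_locales
    fix X assume "X \<in> Obj C"
    then show "(H \<rhd> \<tau>) X \<in> hom E (FObj (H \<circ>\<^sub>F F) X) (FObj (H \<circ>\<^sub>F G) X)"
      by (auto simp: whisker_left_def intro: H.cod.homI)
  next
    fix f X Y assume "f \<in> hom C X Y"
    then have f: "f \<in> Mor C" "Dom C f = X" "Cod C f = Y" "X \<in> Obj C" "Y \<in> Obj C"
      by (auto dest: \<tau>.F.dom.homD)
    then have "FMor H (\<tau> Y \<cdot>\<^bsub>D\<^esub> FMor F f) = FMor H (FMor G f \<cdot>\<^bsub>D\<^esub> \<tau> X)"
      by (simp only: \<tau>.naturality_Mor)
    with f show "(H \<rhd> \<tau>) Y \<cdot>\<^bsub>E\<^esub> FMor (H \<circ>\<^sub>F F) f = FMor (H \<circ>\<^sub>F G) f \<cdot>\<^bsub>E\<^esub> (H \<rhd> \<tau>) X"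
      by (simp add: whisker_left_def)
  qed
qed

lemma nat_trans_whisker_right:
  assumes "nat_trans D E F G \<tau>" "cat_functor C D H"
  shows "nat_trans C E (F \<circ>\<^sub>F H) (G \<circ>\<^sub>F H) (\<tau> \<lhd> H)"
proof -
  interpret \<tau>: nat_trans D E F G \<tau> by fact
  interpret H: cat_functor C D H by fact
  interpret FH: cat_functor C E "F \<circ>\<^sub>F H" by (rule cat_functor_fcomp) unfold_locales
  interpret GH: cat_functor C E "G \<circ>\<^sub>F H" by (rule cat_functor_fcomp) unfold_locales
  show ?thesis
    by unfold_locales
      (auto simp: whisker_right_def H.FMor_hom intro: \<tau>.component_hom \<tau>.naturality)
qed

lemma nat_trans_hcomp:
  assumes "nat_trans D E H K \<sigma>" "nat_trans C D F G \<tau>"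
  shows "nat_trans C E (H \<circ>\<^sub>F F) (K \<circ>\<^sub>F G) (hcomp E H \<sigma> G \<tau>)"
proof -
  interpret \<sigma>: nat_trans D E H K \<sigma> by fact
  interpret \<tau>: nat_trans C D F G \<tau> by fact
  show ?thesis
    unfolding hcomp_def
    by (rule nat_trans_vcomp[OF nat_trans_whisker_left nat_trans_whisker_right]) unfold_locales
qed

section \<open>Units and counits of symmetric regular pairings\<close>

text \<open>The pairing is replaced by its unit and counit. The assumptions are
  \<alpha>\<beta>\<alpha> = \<alpha> at the identity of LX, \<beta>\<alpha>\<beta> = \<beta> at the
  identity of RY, and symmetry, each written in components.\<close>

locale symmetric_regular_units =
  L: cat_functor A B L + R: cat_functor B A R +
  \<eta>: nat_trans A A fid "R \<circ>\<^sub>F L" \<eta> + \<epsilon>: nat_trans B B "L \<circ>\<^sub>F R" fid \<epsilon>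
  for A :: "('oa, 'ma) cat" and B :: "('ob, 'mb) cat" and L R \<eta> \<epsilon> +
  assumes R_ell_unit: "X \<in> Obj A \<Longrightarrow> FMor R (pairing_ell B L \<eta> \<epsilon> X) \<cdot>\<^bsub>A\<^esub> \<eta> X = \<eta> X"
    and counit_L_r: "Y \<in> Obj B \<Longrightarrow> \<epsilon> Y \<cdot>\<^bsub>B\<^esub> FMor L (pairing_r A R \<eta> \<epsilon> Y) = \<epsilon> Y"
    and L_r: "Y \<in> Obj B \<Longrightarrow> FMor L (pairing_r A R \<eta> \<epsilon> Y) = pairing_ell B L \<eta> \<epsilon> (FObj R Y)"
begin

abbreviation "l \<equiv> pairing_ell B L \<eta> \<epsilon>"
abbreviation "r \<equiv> pairing_r A R \<eta> \<epsilon>"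
abbreviation "LR \<equiv> L \<circ>\<^sub>F R"
abbreviation "\<delta> \<equiv> L \<rhd> \<eta> \<lhd> R"
abbreviation "lr \<equiv> hcomp B L l R r"
abbreviation "rl \<equiv> hcomp A R r L l"

section \<open>Component formulas and naturality of the transformations derived from unit and
  counit\<close>

lemma ell_eq: "l X = \<epsilon> (FObj L X) \<cdot>\<^bsub>B\<^esub> FMor L (\<eta> X)"
  by (simp add: pairing_ell_def vcomp_def whisker_left_def whisker_right_def)

lemma r_eq: "r Y = FMor R (\<epsilon> Y) \<cdot>\<^bsub>A\<^esub> \<eta> (FObj R Y)"
  by (simp add: pairing_r_def vcomp_def whisker_left_def whisker_right_def)

lemma delta_eq [simp]: "\<delta> Y = FMor L (\<eta> (FObj R Y))"
  by (simp add: whisker_left_def whisker_right_def)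

lemma lr_eq: "lr Y = l (FObj R Y) \<cdot>\<^bsub>B\<^esub> FMor L (r Y)"
  by (simp add: hcomp_def vcomp_def whisker_left_def whisker_right_def)

lemma rl_eq: "rl X = r (FObj L X) \<cdot>\<^bsub>A\<^esub> FMor R (l X)"
  by (simp add: hcomp_def vcomp_def whisker_left_def whisker_right_def)

sublocale LR: cat_functor B B LR
  by (rule cat_functor_fcomp) unfold_locales

sublocale l: nat_trans A B L L l
proof -
  have "nat_trans A B (L \<circ>\<^sub>F fid) (L \<circ>\<^sub>F R \<circ>\<^sub>F L) (L \<rhd> \<eta>)"
    by (rule nat_trans_whisker_left) unfold_locales
  moreover have "nat_trans A B (LR \<circ>\<^sub>F L) (fid \<circ>\<^sub>F L) (\<epsilon> \<lhd> L)"
    by (rule nat_trans_whisker_right) unfold_locales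
  ultimately show "nat_trans A B L L l"
    unfolding pairing_ell_def by (intro nat_trans_vcomp) auto
qed

sublocale r: nat_trans B A R R r
proof -
  have "nat_trans B A (R \<circ>\<^sub>F LR) (R \<circ>\<^sub>F fid) (R \<rhd> \<epsilon>)"
    by (rule nat_trans_whisker_left) unfold_locales
  moreover have "nat_trans B A (fid \<circ>\<^sub>F R) ((R \<circ>\<^sub>F L) \<circ>\<^sub>F R) (\<eta> \<lhd> R)"
    by (rule nat_trans_whisker_right) unfold_locales
  ultimately show "nat_trans B A R R r"
    unfolding pairing_r_def by (intro nat_trans_vcomp) auto
qed

sublocale \<delta>: nat_trans B B LR "LR \<circ>\<^sub>F LR" \<delta>
proof -
  have "nat_trans B A (fid \<circ>\<^sub>F R) ((R \<circ>\<^sub>F L) \<circ>\<^sub>F R) (\<eta> \<lhd> R)"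
    by (rule nat_trans_whisker_right) unfold_locales
  then have "nat_trans B B LR (L \<circ>\<^sub>F R \<circ>\<^sub>F LR) (L \<rhd> \<eta> \<lhd> R)"
    using nat_trans_whisker_left[OF _ L.cat_functor_axioms] by fastforce
  then show "nat_trans B B LR (LR \<circ>\<^sub>F LR) \<delta>"
    by simp
qed

sublocale rl: nat_trans A A "R \<circ>\<^sub>F L" "R \<circ>\<^sub>F L" rl
  by (rule nat_trans_hcomp) unfold_locales

text \<open>Naturality of \<epsilon> carries the left factor \<open>l X\<close> under
  \<open>R\<close>, next to \<eta>, where \<open>R_ell_unit\<close> absorbs it.\<close>

lemma ell_idem: "X \<in> Obj A \<Longrightarrow> l X \<cdot>\<^bsub>B\<^esub> l X = l X"
proof -
  assume X: "X \<in> Obj A"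
  have "l X \<cdot>\<^bsub>B\<^esub> l X = l X \<cdot>\<^bsub>B\<^esub> (\<epsilon> (FObj L X) \<cdot>\<^bsub>B\<^esub> FMor L (\<eta> X))"
    by (simp add: ell_eq)
  also have "\<dots> = (\<epsilon> (FObj L X) \<cdot>\<^bsub>B\<^esub> FMor L (FMor R (l X))) \<cdot>\<^bsub>B\<^esub> FMor L (\<eta> X)"
    using X \<epsilon>.naturality_Mor[of "l X" "FObj L X" "FObj L X"] by simp
  also have "\<dots> = \<epsilon> (FObj L X) \<cdot>\<^bsub>B\<^esub> FMor L (FMor R (l X) \<cdot>\<^bsub>A\<^esub> \<eta> X)"
    using X by simp
  also have "\<dots> = l X"
    by (simp only: R_ell_unit[OF X]) (simp only: ell_eq)
  finally show ?thesis .
qed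

text \<open>Dual argument: naturality of \<eta> carries the right factor under \<open>L\<close>,
  next to \<epsilon>, where \<open>counit_L_r\<close> absorbs it.\<close>

lemma r_idem: "Y \<in> Obj B \<Longrightarrow> r Y \<cdot>\<^bsub>A\<^esub> r Y = r Y"
proof -
  assume Y: "Y \<in> Obj B"
  have "r Y \<cdot>\<^bsub>A\<^esub> r Y = FMor R (\<epsilon> Y) \<cdot>\<^bsub>A\<^esub> (\<eta> (FObj R Y) \<cdot>\<^bsub>A\<^esub> r Y)"
    using Y by (subst (1) r_eq) simp
  also have "\<dots> = FMor R (\<epsilon> Y \<cdot>\<^bsub>B\<^esub> FMor L (r Y)) \<cdot>\<^bsub>A\<^esub> \<eta> (FObj R Y)"
    using Y \<eta>.naturality_Mor[of "r Y" "FObj R Y" "FObj R Y"] by simp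
  also have "\<dots> = r Y"
    by (simp only: counit_L_r[OF Y]) (simp only: r_eq)
  finally show ?thesis .
qed

text \<open>Naturality of \<open>r\<close> at \<open>l X\<close> exchanges the two middle factors,
  after which \<open>r\<close> and \<open>l\<close> can be collapsed separately.\<close>

lemma rl_idem: "X \<in> Obj A \<Longrightarrow> rl X \<cdot>\<^bsub>A\<^esub> rl X = rl X"
proof -
  assume X: "X \<in> Obj A"
  have "rl X \<cdot>\<^bsub>A\<^esub> rl X
      = r (FObj L X) \<cdot>\<^bsub>A\<^esub> (FMor R (l X) \<cdot>\<^bsub>A\<^esub> r (FObj L X)) \<cdot>\<^bsub>A\<^esub> FMor R (l X)"
    using X by (simp add: rl_eq)
  also have "\<dots> = (r (FObj L X) \<cdot>\<^bsub>A\<^esub> r (FObj L X)) \<cdot>\<^bsub>A\<^esub> FMor R (l X \<cdot>\<^bsub>B\<^esub> l X)"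
    using X by (simp add: r.naturality_Mor[of "l X" "FObj L X" "FObj L X", symmetric])
  also have "\<dots> = rl X"
    by (simp only: r_idem[OF L.FObj_Obj[OF X]] ell_idem[OF X] rl_eq)
  finally show ?thesis .
qed

text \<open>By symmetry both factors of \<open>lr Y\<close> equal \<open>l (FObj R Y)\<close>, which
  is idempotent.\<close>

lemma lr_eq_L_r: "Y \<in> Obj B \<Longrightarrow> lr Y = FMor L (r Y)"
  by (simp add: lr_eq L_r ell_idem)

text \<open>Coassociativity is the image under \<open>L\<close> of the naturality square of \<eta>
  at its own component. The remaining three axioms are, in this order, \<open>counit_L_r\<close>,
  the image of \<open>R_ell_unit\<close> under \<open>L\<close>, and symmetry in the form
  \<open>L_r\<close>.\<close>

sublocale weak_comonad B LR \<delta> \<epsilon>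
proof
  show "nt_eq B (vcomp B (LR \<rhd> \<delta>) \<delta>) (vcomp B (\<delta> \<lhd> LR) \<delta>)"
    unfolding nt_eq_def
  proof
    fix Y assume Y: "Y \<in> Obj B"
    have "FMor L (FMor R (FMor L (\<eta> (FObj R Y))) \<cdot>\<^bsub>A\<^esub> \<eta> (FObj R Y))
        = FMor L (\<eta> (FObj R (FObj L (FObj R Y))) \<cdot>\<^bsub>A\<^esub> \<eta> (FObj R Y))"
      using Y \<eta>.naturality_Mor[of "\<eta> (FObj R Y)" "FObj R Y" "FObj R (FObj L (FObj R Y))"] by simp
    with Y show "vcomp B (LR \<rhd> \<delta>) \<delta> Y = vcomp B (\<delta> \<lhd> LR) \<delta> Y"
      by (simp add: vcomp_def whisker_left_def whisker_right_def)
  qed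
  show "nt_eq B \<epsilon> (vcomp B \<epsilon> (vcomp B (LR \<rhd> \<epsilon>) \<delta>))"
    unfolding nt_eq_def
  proof
    fix Y assume Y: "Y \<in> Obj B"
    then show "\<epsilon> Y = vcomp B \<epsilon> (vcomp B (LR \<rhd> \<epsilon>) \<delta>) Y"
      using counit_L_r[OF Y] by (simp add: r_eq vcomp_def whisker_left_def whisker_right_def)
  qed
  show "nt_eq B \<delta> (vcomp B (LR \<rhd> (\<epsilon> \<lhd> LR)) (vcomp B (LR \<rhd> \<delta>) \<delta>))"
    unfolding nt_eq_def
  proof
    fix Y assume Y: "Y \<in> Obj B"
    have "FMor L (\<eta> (FObj R Y)) = FMor L (FMor R (l (FObj R Y)) \<cdot>\<^bsub>A\<^esub> \<eta> (FObj R Y))"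
      using Y by (simp only: R_ell_unit R.FObj_Obj)
    with Y show "\<delta> Y = vcomp B (LR \<rhd> (\<epsilon> \<lhd> LR)) (vcomp B (LR \<rhd> \<delta>) \<delta>) Y"
      by (simp add: ell_eq vcomp_def whisker_left_def whisker_right_def)
  qed
  show "nt_eq B (vcomp B (LR \<rhd> \<epsilon>) \<delta>) (vcomp B (\<epsilon> \<lhd> LR) \<delta>)"
    unfolding nt_eq_def
  proof
    fix Y assume Y: "Y \<in> Obj B"
    then show "vcomp B (LR \<rhd> \<epsilon>) \<delta> Y = vcomp B (\<epsilon> \<lhd> LR) \<delta> Y"
      using L_r[OF Y]
      by (simp add: r_eq ell_eq vcomp_def whisker_left_def whisker_right_def)
  qed
qed

text \<open>The comodule law of the cofree object is coassociativity of \<delta> at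
  \<open>Y\<close>.\<close>

lemma comodule_free:
  assumes Y: "Y \<in> Obj B"
  shows "noncounital_comodule B LR \<delta> (FObj LR Y) (\<delta> Y)"
  using Y coassoc
  by (auto simp: noncounital_comodule_def nt_eq_def vcomp_def whisker_left_def whisker_right_def
      intro: L.cod.homI)

end

section \<open>The Frobenius action\<close>

text \<open>The transformation \<open>\<epsilon>\<^sub>h\<close> of part (1) is used only through the invariance
  \<open>\<epsilon>\<^sub>h = \<epsilon>\<^sub>h \<cdot> rl\<close>.\<close>

locale frobenius_counit = symmetric_regular_units +
  \<epsilon>h: nat_trans A A "R \<circ>\<^sub>F L" fid \<epsilon>h for \<epsilon>h +
  assumes counit_rl: "X \<in> Obj A \<Longrightarrow> \<epsilon>h X \<cdot>\<^bsub>A\<^esub> rl X = \<epsilon>h X"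
begin

abbreviation "action \<equiv> frobenius_action B L R \<epsilon> \<epsilon>h"

text \<open>Naturality of \<open>\<epsilon>h\<close> moves \<open>r\<close> to the other side as
  RLr, which symmetry turns into R applied to \<open>l\<close>. The factor \<open>rl\<close>
  supplied by invariance already ends in this idempotent and absorbs it.\<close>

lemma r_counit:
  assumes Y: "Y \<in> Obj B"
  shows "r Y \<cdot>\<^bsub>A\<^esub> \<epsilon>h (FObj R Y) = \<epsilon>h (FObj R Y)"
proof -
  let ?X = "FObj R Y"
  have X: "?X \<in> Obj A" and LX: "FObj L ?X \<in> Obj B" using Y by auto
  have "r Y \<cdot>\<^bsub>A\<^esub> \<epsilon>h ?X = \<epsilon>h ?X \<cdot>\<^bsub>A\<^esub> FMor R (FMor L (r Y))"
    using Y \<epsilon>h.naturality_Mor[of "r Y" ?X ?X] by simp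
  also have "\<dots> = (\<epsilon>h ?X \<cdot>\<^bsub>A\<^esub> rl ?X) \<cdot>\<^bsub>A\<^esub> FMor R (l ?X)"
    by (simp only: counit_rl[OF X] L_r[OF Y])
  also have "\<dots> = \<epsilon>h ?X \<cdot>\<^bsub>A\<^esub> r (FObj L ?X) \<cdot>\<^bsub>A\<^esub> FMor R (l ?X \<cdot>\<^bsub>B\<^esub> l ?X)"
    using X LX by (simp add: rl_eq)
  also have "\<dots> = \<epsilon>h ?X \<cdot>\<^bsub>A\<^esub> rl ?X"
    using X LX by (simp add: ell_idem rl_eq)
  finally show ?thesis
    by (simp only: counit_rl[OF X])
qed

lemma L_r_L_counit:
  assumes Y: "Y \<in> Obj B"
  shows "FMor L (r Y) \<cdot>\<^bsub>B\<^esub> FMor L (\<epsilon>h (FObj R Y)) = FMor L (\<epsilon>h (FObj R Y))"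
  using arg_cong[OF r_counit[OF Y], of "FMor L"] Y by simp

lemma lr_counit:
  assumes Y: "Y \<in> Obj B"
  shows "lr Y \<cdot>\<^bsub>B\<^esub> FMor L (\<epsilon>h (FObj R Y)) = FMor L (\<epsilon>h (FObj R Y))"
  by (simp only: lr_eq_L_r[OF Y] L_r_L_counit[OF Y])

text \<open>The morphism law is the image under \<open>L\<close> of naturality of \<eta> at
  \<open>\<epsilon>h\<close>. For compatibility, the composite of counit and coaction is a component
  of \<open>l\<close>; naturality moves it to the left, where it equals Lr and is absorbed by
  \<open>L_r_L_counit\<close>.\<close>

lemma counit_compatible_mor:
  assumes Y: "Y \<in> Obj B"
  shows "compatible_comodule_mor B LR \<delta> \<epsilon>
    (FObj LR (FObj LR Y)) (\<delta> (FObj LR Y)) (FObj LR Y) (\<delta> Y) ((L \<rhd> \<epsilon>h \<lhd> R) Y)"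
proof -
  let ?X = "FObj R Y" and ?X' = "FObj R (FObj L (FObj R Y))"
  have [simp]: "?X \<in> Obj A" "?X' \<in> Obj A" using Y by auto
  have "FMor L (\<eta> ?X \<cdot>\<^bsub>A\<^esub> \<epsilon>h ?X) = FMor L (FMor R (FMor L (\<epsilon>h ?X)) \<cdot>\<^bsub>A\<^esub> \<eta> ?X')"
    using \<eta>.naturality_Mor[of "\<epsilon>h ?X" ?X' ?X] by simp
  then have "\<delta> Y \<cdot>\<^bsub>B\<^esub> FMor L (\<epsilon>h ?X) = FMor LR (FMor L (\<epsilon>h ?X)) \<cdot>\<^bsub>B\<^esub> \<delta> (FObj LR Y)"
    by simp
  moreover have "FMor L (\<epsilon>h ?X) \<cdot>\<^bsub>B\<^esub> l ?X' = FMor L (\<epsilon>h ?X)"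
    using l.naturality_Mor[of "\<epsilon>h ?X" ?X' ?X] L_r_L_counit[OF Y] L_r[OF Y] by simp
  ultimately show ?thesis
    using Y comodule_free[of Y] comodule_free[of "FObj LR Y"]
    by (auto simp: compatible_comodule_mor_def comodule_mor_def whisker_left_def
        whisker_right_def ell_eq intro: L.cod.homI)
qed

lemma action_eq:
  assumes Y: "Y \<in> Obj B" and \<omega>: "\<omega> \<in> hom B Y (FObj LR Y)"
  shows "action Y \<omega> = \<epsilon> Y \<cdot>\<^bsub>B\<^esub> FMor L (\<epsilon>h (FObj R Y) \<cdot>\<^bsub>A\<^esub> FMor R \<omega>)"
  using Y L.cod.homD[OF \<omega>] by (simp add: frobenius_action_def)

text \<open>The endomorphism \<open>x\<close> is kept opaque behind its defining equation, which
  \<open>refl\<close> discharges outside this context; its main uses are through \<open>r_x\<close>,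
  \<open>ell_L_x\<close> and naturality squares.\<close>

context
  fixes Y \<omega> x
  assumes comod: "noncounital_comodule B LR \<delta> Y \<omega>"
    and x: "x = \<epsilon>h (FObj R Y) \<cdot>\<^bsub>A\<^esub> FMor R \<omega>"
begin

lemma comodule_typing [simp]:
  "Y \<in> Obj B" "\<omega> \<in> Mor B" "Dom B \<omega> = Y" "Cod B \<omega> = FObj L (FObj R Y)"
  using comod L.cod.homD[of \<omega>] by (auto simp: noncounital_comodule_def)

lemma x_typing [simp]: "x \<in> Mor A" "Dom A x = FObj R Y" "Cod A x = FObj R Y"
  by (simp_all add: x)

lemma action_x: "action Y \<omega> = \<epsilon> Y \<cdot>\<^bsub>B\<^esub> FMor L x"
  unfolding x by (rule action_eq) (auto intro: L.cod.homI)

lemma action_typing [simp]: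
  "action Y \<omega> \<in> Mor B" "Dom B (action Y \<omega>) = FObj L (FObj R Y)" "Cod B (action Y \<omega>) = Y"
  by (simp_all add: action_x)

lemma r_x: "r Y \<cdot>\<^bsub>A\<^esub> x = x"
  using L.dom.Comp_extend[OF r_counit, of Y "FMor R \<omega>"] by (simp add: x)

lemma ell_L_x: "l (FObj R Y) \<cdot>\<^bsub>B\<^esub> FMor L x = FMor L x"
  using arg_cong[OF r_x, of "FMor L"] L_r[of Y] by simp

text \<open>This is the key identity: the coaction cancels the counit in
  \<open>action Y \<omega> = \<epsilon> Y \<cdot> FMor L x\<close>. Both halves of the proof slide a
  map through a counit, first through \<open>\<epsilon>h\<close> and then through
  \<epsilon>.\<close>

lemma coaction_action: "\<omega> \<cdot>\<^bsub>B\<^esub> action Y \<omega> = FMor L x"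
proof -
  let ?X = "FObj R Y" and ?Y' = "FObj L (FObj R Y)"
  have "FMor R \<omega> \<cdot>\<^bsub>A\<^esub> x = \<epsilon>h (FObj R ?Y') \<cdot>\<^bsub>A\<^esub> FMor R (FMor L (FMor R \<omega>) \<cdot>\<^bsub>B\<^esub> \<omega>)"
    using L.dom.Comp_extend[OF \<epsilon>h.naturality_Mor[of "FMor R \<omega>" ?X "FObj R ?Y'"], of "FMor R \<omega>"]
    by (simp add: x)
  also have "\<dots> = (\<epsilon>h (FObj R ?Y') \<cdot>\<^bsub>A\<^esub> FMor R (FMor L (\<eta> ?X))) \<cdot>\<^bsub>A\<^esub> FMor R \<omega>"
    using comod by (simp add: noncounital_comodule_def)
  also have "\<dots> = \<eta> ?X \<cdot>\<^bsub>A\<^esub> x"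
    using \<epsilon>h.naturality_Mor[of "\<eta> ?X" ?X "FObj R ?Y'"] by (simp add: x)
  \<comment> \<open>After \<open>x\<close>, the maps R\<omega> and \<eta> agree: the comodule law,
    placed under \<open>\<epsilon>h\<close>, trades one for the other.\<close>
  finally have *: "FMor R \<omega> \<cdot>\<^bsub>A\<^esub> x = \<eta> ?X \<cdot>\<^bsub>A\<^esub> x" .
  have "\<omega> \<cdot>\<^bsub>B\<^esub> action Y \<omega> = (\<omega> \<cdot>\<^bsub>B\<^esub> \<epsilon> Y) \<cdot>\<^bsub>B\<^esub> FMor L x"
    by (simp add: action_x)
  also have "\<dots> = \<epsilon> ?Y' \<cdot>\<^bsub>B\<^esub> FMor L (FMor R \<omega> \<cdot>\<^bsub>A\<^esub> x)"
    using \<epsilon>.naturality_Mor[of \<omega> Y ?Y', symmetric] by simp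
  also have "\<dots> = l ?X \<cdot>\<^bsub>B\<^esub> FMor L x"
    by (simp add: * ell_eq)
  finally show ?thesis
    by (simp only: ell_L_x)
qed

text \<open>Moving \<eta> to the left past \<open>x\<close> completes \<open>r Y\<close>, which
  fixes \<open>x\<close>.\<close>

lemma LR_action_delta: "FMor LR (action Y \<omega>) \<cdot>\<^bsub>B\<^esub> \<delta> Y = FMor L x"
proof -
  let ?X = "FObj R Y"
  have "FMor LR (action Y \<omega>) \<cdot>\<^bsub>B\<^esub> \<delta> Y
      = FMor L (FMor R (\<epsilon> Y) \<cdot>\<^bsub>A\<^esub> (FMor R (FMor L x) \<cdot>\<^bsub>A\<^esub> \<eta> ?X))"
    by (simp add: action_x)
  also have "\<dots> = FMor L (r Y \<cdot>\<^bsub>A\<^esub> x)"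
    using \<eta>.naturality_Mor[of x ?X ?X] by (simp add: r_eq)
  finally show ?thesis
    by (simp only: r_x)
qed

text \<open>By \<open>coaction_action\<close> the coaction inside \<open>x\<close> meets the action
  and leaves Lx, which naturality of \<open>\<epsilon>h\<close> moves out. Applying \<open>L\<close>
  and composing with \<epsilon> gives the module law.\<close>

lemma action_module: "nonunital_module B LR (L \<rhd> \<epsilon>h \<lhd> R) Y (action Y \<omega>)"
proof -
  let ?X = "FObj R Y"
  have "x \<cdot>\<^bsub>A\<^esub> FMor R (action Y \<omega>) = \<epsilon>h ?X \<cdot>\<^bsub>A\<^esub> FMor R (\<omega> \<cdot>\<^bsub>B\<^esub> action Y \<omega>)"
    by (simp add: x)
  also have "\<dots> = x \<cdot>\<^bsub>A\<^esub> \<epsilon>h ?X"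
    using \<epsilon>h.naturality_Mor[of x ?X ?X] by (simp add: coaction_action)
  finally have "FMor L (x \<cdot>\<^bsub>A\<^esub> FMor R (action Y \<omega>)) = FMor L (x \<cdot>\<^bsub>A\<^esub> \<epsilon>h ?X)"
    by (rule arg_cong)
  then have "FMor L x \<cdot>\<^bsub>B\<^esub> FMor L (FMor R (action Y \<omega>)) = FMor L x \<cdot>\<^bsub>B\<^esub> FMor L (\<epsilon>h ?X)"
    by simp
  then have "action Y \<omega> \<cdot>\<^bsub>B\<^esub> FMor LR (action Y \<omega>) = action Y \<omega> \<cdot>\<^bsub>B\<^esub> FMor L (\<epsilon>h ?X)"
    \<comment> \<open>Only the two outer actions are expanded, so that the preceding equation still
      matches the inner one.\<close>
    by (subst (1 3) action_x) simp
  then show ?thesis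
    by (auto simp: nonunital_module_def whisker_left_def whisker_right_def intro: L.cod.homI)
qed

text \<open>All three composites in the Frobenius law equal \<open>FMor L x\<close>.\<close>

lemma action_frobenius: "frobenius_bimodule B L R \<eta> \<epsilon>h Y (action Y \<omega>) \<omega>"
  unfolding frobenius_bimodule_def
  using action_module comod LR_action_delta coaction_action by (simp add: x)

lemma action_compatible_mor:
  "compatible_comodule_mor B LR \<delta> \<epsilon> (FObj LR Y) (\<delta> Y) Y \<omega> (action Y \<omega>)"
proof -
  let ?X = "FObj R Y"
  have "action Y \<omega> \<cdot>\<^bsub>B\<^esub> l ?X = \<epsilon> Y \<cdot>\<^bsub>B\<^esub> (l ?X \<cdot>\<^bsub>B\<^esub> FMor L x)"
    using l.naturality_Mor[of x ?X ?X] by (simp add: action_x)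
  also have "\<dots> = action Y \<omega>"
    by (simp add: ell_L_x action_x)
  finally show ?thesis
    using comod comodule_free[of Y] LR_action_delta coaction_action
    by (auto simp: compatible_comodule_mor_def comodule_mor_def ell_eq intro: L.cod.homI)
qed

lemma action_unique:
  assumes mor: "compatible_comodule_mor B LR \<delta> \<epsilon> (FObj LR Y) (\<delta> Y) Y \<omega> \<rho>"
    and frob: "frobenius_bimodule B L R \<eta> \<epsilon>h Y \<rho> \<omega>"
  shows "\<rho> = action Y \<omega>"
proof -
  \<comment> \<open>Naturality of \<epsilon> turns the compatibility condition on the source
    comodule into the equivalent one on the target, so a compatible morphism is recovered from its
    composite with \<omega>.\<close>
  have eps: "\<epsilon> Y \<cdot>\<^bsub>B\<^esub> (\<omega> \<cdot>\<^bsub>B\<^esub> \<sigma>) = \<sigma>"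
    if "compatible_comodule_mor B LR \<delta> \<epsilon> (FObj LR Y) (\<delta> Y) Y \<omega> \<sigma>" for \<sigma>
  proof -
    have \<sigma>: "\<sigma> \<in> Mor B" "Dom B \<sigma> = FObj L (FObj R Y)" "Cod B \<sigma> = Y"
      and mor: "\<omega> \<cdot>\<^bsub>B\<^esub> \<sigma> = FMor LR \<sigma> \<cdot>\<^bsub>B\<^esub> \<delta> Y" "\<sigma> \<cdot>\<^bsub>B\<^esub> \<epsilon> (FObj LR Y) \<cdot>\<^bsub>B\<^esub> \<delta> Y = \<sigma>"
      using that L.cod.homD[of \<sigma>] by (auto simp: compatible_comodule_mor_def comodule_mor_def)
    have "\<epsilon> Y \<cdot>\<^bsub>B\<^esub> (\<omega> \<cdot>\<^bsub>B\<^esub> \<sigma>) = (\<epsilon> Y \<cdot>\<^bsub>B\<^esub> FMor LR \<sigma>) \<cdot>\<^bsub>B\<^esub> \<delta> Y"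
      using \<sigma> mor(1) by simp
    also have "\<dots> = \<sigma> \<cdot>\<^bsub>B\<^esub> \<epsilon> (FObj LR Y) \<cdot>\<^bsub>B\<^esub> \<delta> Y"
      using \<sigma> \<epsilon>.naturality_Mor[of \<sigma> "FObj LR Y" Y] by simp
    finally show ?thesis
      by (simp only: mor(2))
  qed
  \<comment> \<open>The Frobenius law equates both sides with a composite that depends only on
    \<open>\<epsilon>h\<close> and \<omega>.\<close>
  have "\<omega> \<cdot>\<^bsub>B\<^esub> \<rho> = \<omega> \<cdot>\<^bsub>B\<^esub> action Y \<omega>"
    using frob action_frobenius by (simp add: frobenius_bimodule_def)
  then show ?thesis
    by (metis eps[OF mor] eps[OF action_compatible_mor])
qed

end

text \<open>Naturality of \<open>\<epsilon>h\<close> and the comodule morphism law show that Rh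
  intertwines the endomorphisms \<open>x\<close> of the two comodules. Naturality of \<epsilon> at
  \<open>h\<close> then transfers this to the actions.\<close>

lemma comodule_mor_frobenius:
  assumes h: "comodule_mor B LR \<delta> Y \<omega> Y' \<omega>' h"
  shows "frobenius_bimodule_mor B L R \<eta> \<epsilon>h Y (action Y \<omega>) \<omega> Y' (action Y' \<omega>') \<omega>' h"
proof -
  have \<omega>: "noncounital_comodule B LR \<delta> Y \<omega>" and \<omega>': "noncounital_comodule B LR \<delta> Y' \<omega>'"
    and hH: "h \<in> hom B Y Y'" and mor: "\<omega>' \<cdot>\<^bsub>B\<^esub> h = FMor LR h \<cdot>\<^bsub>B\<^esub> \<omega>"
    using h by (auto simp: comodule_mor_def)
  note [simp] = comodule_typing[OF \<omega> refl] comodule_typing[OF \<omega>' refl] L.cod.homD[OF hH]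
  let ?X = "FObj R Y" and ?X' = "FObj R Y'"
  have "FMor R h \<cdot>\<^bsub>A\<^esub> \<epsilon>h ?X \<cdot>\<^bsub>A\<^esub> FMor R \<omega> = \<epsilon>h ?X' \<cdot>\<^bsub>A\<^esub> FMor R (FMor LR h \<cdot>\<^bsub>B\<^esub> \<omega>)"
    using L.dom.Comp_extend[OF \<epsilon>h.naturality_Mor[of "FMor R h" ?X ?X'], of "FMor R \<omega>"] by simp
  also have "\<dots> = \<epsilon>h ?X' \<cdot>\<^bsub>A\<^esub> FMor R \<omega>' \<cdot>\<^bsub>A\<^esub> FMor R h"
    by (simp only: mor[symmetric]) simp
  finally have *: "FMor R h \<cdot>\<^bsub>A\<^esub> \<epsilon>h ?X \<cdot>\<^bsub>A\<^esub> FMor R \<omega> = \<epsilon>h ?X' \<cdot>\<^bsub>A\<^esub> FMor R \<omega>' \<cdot>\<^bsub>A\<^esub> FMor R h" .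
  have "h \<cdot>\<^bsub>B\<^esub> action Y \<omega> = (h \<cdot>\<^bsub>B\<^esub> \<epsilon> Y) \<cdot>\<^bsub>B\<^esub> FMor L (\<epsilon>h ?X \<cdot>\<^bsub>A\<^esub> FMor R \<omega>)"
    by (simp add: action_x[OF \<omega> refl])
  also have "\<dots> = \<epsilon> Y' \<cdot>\<^bsub>B\<^esub> FMor L (FMor R h \<cdot>\<^bsub>A\<^esub> \<epsilon>h ?X \<cdot>\<^bsub>A\<^esub> FMor R \<omega>)"
    using \<epsilon>.naturality_Mor[of h Y Y', symmetric] by simp
  also have "\<dots> = action Y' \<omega>' \<cdot>\<^bsub>B\<^esub> FMor LR h"
    unfolding * by (simp add: action_x[OF \<omega>' refl])
  finally show ?thesis
    unfolding frobenius_bimodule_mor_def module_mor_def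
    by (intro conjI h hH action_frobenius[OF _ refl] action_module[OF _ refl] \<omega> \<omega>')
qed

end

section \<open>Regular pairings\<close>

context pairing
begin

abbreviation "\<eta> \<equiv> pairing_unit B L \<alpha>"
abbreviation "\<epsilon> \<equiv> pairing_counit A R \<beta>"

lemma unit_eq: "\<eta> X = \<alpha> X (FObj L X) (Id B (FObj L X))"
  by (simp add: pairing_unit_def)

lemma counit_eq: "\<epsilon> Y = \<beta> (FObj R Y) Y (Id A (FObj R Y))"
  by (simp add: pairing_counit_def)

lemma unit_typing [simp]:
  assumes "X \<in> Obj A"
  shows "\<eta> X \<in> Mor A" "Dom A (\<eta> X) = X" "Cod A (\<eta> X) = FObj R (FObj L X)"
  using L.dom.homD[OF funcset_mem[OF \<alpha>_hom[OF assms] L.cod.Id_hom]] assms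
  by (auto simp: pairing_unit_def)

lemma counit_typing [simp]:
  assumes "Y \<in> Obj B"
  shows "\<epsilon> Y \<in> Mor B" "Dom B (\<epsilon> Y) = FObj L (FObj R Y)" "Cod B (\<epsilon> Y) = Y"
  using L.cod.homD[OF funcset_mem[OF \<beta>_hom[OF _ assms] L.dom.Id_hom]] assms
  by (auto simp: pairing_counit_def)

text \<open>A Yoneda argument: naturality in the second variable, evaluated at the identity of LX.
  The formula for \<beta> below is dual.\<close>

lemma \<alpha>_eq:
  assumes X: "X \<in> Obj A" and f: "f \<in> Mor B" "Dom B f = FObj L X" "Cod B f = Y"
  shows "\<alpha> X Y f = FMor R f \<cdot>\<^bsub>A\<^esub> \<eta> X"
  using \<alpha>_natural[OF L.dom.Id_hom[OF X] L.cod.homI[OF f] L.cod.Id_hom] X f L.cod.Cod_Obj[of f]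
  by (simp add: L.FMor_Id flip: unit_eq)

lemma \<beta>_eq:
  assumes Y: "Y \<in> Obj B" and g: "g \<in> Mor A" "Dom A g = X" "Cod A g = FObj R Y"
  shows "\<beta> X Y g = \<epsilon> Y \<cdot>\<^bsub>B\<^esub> FMor L g"
  using \<beta>_natural[OF L.dom.homI[OF g] L.cod.Id_hom[OF Y] L.dom.Id_hom] Y g
    counit_typing[OF Y]
  by (simp add: R.FMor_Id flip: counit_eq)

text \<open>Both paths of the square are \<alpha> applied to La: one by naturality in the first
  variable at an identity, the other by \<open>\<alpha>_eq\<close>.\<close>

lemma unit_nat_trans: "nat_trans A A fid (R \<circ>\<^sub>F L) \<eta>"
proof -
  interpret fid: cat_functor A A fid by (rule cat_functor_fid) unfold_locales
  interpret RL: cat_functor A A "R \<circ>\<^sub>F L" by (rule cat_functor_fcomp) unfold_locales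
  show ?thesis
  proof unfold_locales
    fix a X Y assume a: "a \<in> hom A X Y"
    note [simp] = L.dom.homD[OF a]
    have "\<eta> Y \<cdot>\<^bsub>A\<^esub> a = \<alpha> X (FObj L Y) (FMor L a)"
      using \<alpha>_natural[OF a L.cod.Id_hom[of "FObj L Y"] L.cod.Id_hom[of "FObj L Y"]] unit_typing[of Y]
      by (simp add: R.FMor_Id flip: unit_eq)
    then show "\<eta> Y \<cdot>\<^bsub>A\<^esub> FMor fid a = FMor (R \<circ>\<^sub>F L) a \<cdot>\<^bsub>A\<^esub> \<eta> X"
      by (simp add: \<alpha>_eq)
  qed (auto intro: L.dom.homI)
qed

lemma counit_nat_trans: "nat_trans B B (L \<circ>\<^sub>F R) fid \<epsilon>"
proof -
  interpret fid: cat_functor B B fid by (rule cat_functor_fid) unfold_locales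
  interpret LR: cat_functor B B "L \<circ>\<^sub>F R" by (rule cat_functor_fcomp) unfold_locales
  show ?thesis
  proof unfold_locales
    fix b X Y assume b: "b \<in> hom B X Y"
    note [simp] = L.cod.homD[OF b]
    have "b \<cdot>\<^bsub>B\<^esub> \<epsilon> X = \<beta> (FObj R X) Y (FMor R b)"
      using \<beta>_natural[OF L.dom.Id_hom[of "FObj R X"] b L.dom.Id_hom[of "FObj R X"]] counit_typing[of X]
      by (simp add: L.FMor_Id flip: counit_eq)
    then show "\<epsilon> Y \<cdot>\<^bsub>B\<^esub> FMor (L \<circ>\<^sub>F R) b = FMor fid b \<cdot>\<^bsub>B\<^esub> \<epsilon> X"
      by (simp add: \<beta>_eq)
  qed (auto intro: L.cod.homI)
qed

end

text \<open>Evaluating the regularity laws at identities and expanding by \<open>\<alpha>_eq\<close>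
  and \<open>\<beta>_eq\<close> produces exactly the composites that define \<open>l\<close> and
  \<open>r\<close>.\<close>

lemma (in regular_pairing) symmetric_regular_units:
  assumes "symmetric_pairing A B L R \<alpha> \<beta>"
  shows "symmetric_regular_units A B L R \<eta> \<epsilon>"
proof -
  interpret \<eta>: nat_trans A A fid "R \<circ>\<^sub>F L" \<eta> by (rule unit_nat_trans)
  interpret \<epsilon>: nat_trans B B "L \<circ>\<^sub>F R" fid \<epsilon> by (rule counit_nat_trans)
  show ?thesis
  proof unfold_locales
    fix X assume X: "X \<in> Obj A"
    have "\<alpha> X (FObj L X) (Id B (FObj L X)) = \<eta> X"
      by (simp add: pairing_unit_def)
    with \<alpha>\<beta>\<alpha>[OF X L.FObj_Obj[OF X] L.cod.Id_hom[OF L.FObj_Obj[OF X]]]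
    have "\<alpha> X (FObj L X) (\<beta> X (FObj L X) (\<eta> X)) = \<eta> X" by simp
    with X show "FMor R (pairing_ell B L \<eta> \<epsilon> X) \<cdot>\<^bsub>A\<^esub> \<eta> X = \<eta> X"
      by (simp add: \<alpha>_eq \<beta>_eq pairing_ell_def vcomp_def whisker_left_def whisker_right_def)
  next
    fix Y assume Y: "Y \<in> Obj B"
    have "\<beta> (FObj R Y) Y (Id A (FObj R Y)) = \<epsilon> Y"
      by (simp add: pairing_counit_def)
    with \<beta>\<alpha>\<beta>[OF R.FObj_Obj[OF Y] Y L.dom.Id_hom[OF R.FObj_Obj[OF Y]]]
    have "\<beta> (FObj R Y) Y (\<alpha> (FObj R Y) Y (\<epsilon> Y)) = \<epsilon> Y" by simp
    with Y show "\<epsilon> Y \<cdot>\<^bsub>B\<^esub> FMor L (pairing_r A R \<eta> \<epsilon> Y) = \<epsilon> Y"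
      by (simp add: \<alpha>_eq \<beta>_eq pairing_r_def vcomp_def whisker_left_def whisker_right_def)
  next
    fix Y assume "Y \<in> Obj B"
    then show "FMor L (pairing_r A R \<eta> \<epsilon> Y) = pairing_ell B L \<eta> \<epsilon> (FObj R Y)"
      using assms
      by (simp add: symmetric_pairing_def Let_def nt_eq_def whisker_left_def whisker_right_def)
  qed
qed

theorem theorem3p9:
  fixes A :: "('oa, 'ma) cat" and B :: "('ob, 'mb) cat"
    and L :: "('oa, 'ma, 'ob, 'mb) func" and R :: "('ob, 'mb, 'oa, 'ma) func"
    and \<alpha> :: "'oa \<Rightarrow> 'ob \<Rightarrow> 'mb \<Rightarrow> 'ma" and \<beta> :: "'oa \<Rightarrow> 'ob \<Rightarrow> 'ma \<Rightarrow> 'mb"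
    and \<eta> \<epsilon>t \<epsilon>h rl :: "'oa \<Rightarrow> 'ma" and \<epsilon> lr \<delta> :: "'ob \<Rightarrow> 'mb"
    and l :: "'oa \<Rightarrow> 'mb" and r :: "'ob \<Rightarrow> 'ma"
    and LR :: "('ob, 'mb, 'ob, 'mb) func"
  assumes regular: "regular_pairing A B L R \<alpha> \<beta>"
    and symmetric: "symmetric_pairing A B L R \<alpha> \<beta>"
    and \<eta>: "\<eta> = pairing_unit B L \<alpha>"
    and \<epsilon>: "\<epsilon> = pairing_counit A R \<beta>"
    and l: "l = pairing_ell B L \<eta> \<epsilon>"
    and r: "r = pairing_r A R \<eta> \<epsilon>"
    and lr: "lr = hcomp B L l R r"
    and rl: "rl = hcomp A R r L l"
    and LR: "LR = L \<circ>\<^sub>F R"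
    and \<delta>: "\<delta> = L \<rhd> \<eta> \<lhd> R"
    and \<epsilon>t: "nat_trans A A (R \<circ>\<^sub>F L) fid \<epsilon>t"
    and \<epsilon>h: "\<epsilon>h = vcomp A \<epsilon>t rl"
  shows
    "(nat_trans A A (R \<circ>\<^sub>F L) fid \<epsilon>h \<and>
      nt_eq A \<epsilon>h (vcomp A \<epsilon>h rl) \<and>
      nt_eq B (vcomp B lr (L \<rhd> \<epsilon>h \<lhd> R)) (L \<rhd> \<epsilon>h \<lhd> R) \<and>
      (\<forall>Y\<in>Obj B. compatible_comodule_mor B LR \<delta> \<epsilon>
          (FObj LR (FObj LR Y)) (\<delta> (FObj LR Y)) (FObj LR Y) (\<delta> Y) ((L \<rhd> \<epsilon>h \<lhd> R) Y))) \<and>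
     (weak_comonad B LR \<delta> \<epsilon> \<and>
      (\<forall>Y \<omega>. compatible_comodule B LR \<delta> lr Y \<omega> \<longrightarrow>
        (\<exists>!\<rho>. compatible_comodule_mor B LR \<delta> \<epsilon> (FObj LR Y) (\<delta> Y) Y \<omega> \<rho> \<and>
              frobenius_bimodule B L R \<eta> \<epsilon>h Y \<rho> \<omega>) \<and>
        (compatible_comodule_mor B LR \<delta> \<epsilon> (FObj LR Y) (\<delta> Y) Y \<omega>
            (frobenius_action B L R \<epsilon> \<epsilon>h Y \<omega>) \<and>
         frobenius_bimodule B L R \<eta> \<epsilon>h Y (frobenius_action B L R \<epsilon> \<epsilon>h Y \<omega>) \<omega>))) \<and>
     (\<forall>Y \<omega> Y' \<omega>' h.
        compatible_comodule B LR \<delta> lr Y \<omega> \<longrightarrow> compatible_comodule B LR \<delta> lr Y' \<omega>' \<longrightarrow>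
        comodule_mor B LR \<delta> Y \<omega> Y' \<omega>' h \<longrightarrow>
        frobenius_bimodule_mor B L R \<eta> \<epsilon>h
          Y (frobenius_action B L R \<epsilon> \<epsilon>h Y \<omega>) \<omega>
          Y' (frobenius_action B L R \<epsilon> \<epsilon>h Y' \<omega>') \<omega>' h)"
proof -
  interpret P: regular_pairing A B L R \<alpha> \<beta> by (rule regular)
  interpret S: symmetric_regular_units A B L R \<eta> \<epsilon>
    unfolding \<eta> \<epsilon> by (rule P.symmetric_regular_units[OF symmetric])
  interpret \<epsilon>t: nat_trans A A "R \<circ>\<^sub>F L" fid \<epsilon>t by (rule \<epsilon>t)
  have nat: "nat_trans A A (R \<circ>\<^sub>F L) fid \<epsilon>h"
    unfolding \<epsilon>h rl l r by (rule nat_trans_vcomp[OF S.rl.nat_trans_axioms \<epsilon>t])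
  \<comment> \<open>Since \<open>\<epsilon>h\<close> already ends in \<open>rl\<close>, idempotence
    of \<open>rl\<close> gives the invariance.\<close>
  have inv: "\<epsilon>h X \<cdot>\<^bsub>A\<^esub> S.rl X = \<epsilon>h X" if "X \<in> Obj A" for X
    using that S.rl_idem[OF that] by (simp add: \<epsilon>h rl l r vcomp_def)
  interpret F: frobenius_counit A B L R \<eta> \<epsilon> \<epsilon>h
    by (intro frobenius_counit.intro frobenius_counit_axioms.intro nat inv)
      unfold_locales
  have comod: "noncounital_comodule B LR \<delta> Y \<omega>"
    if "compatible_comodule B LR \<delta> lr Y \<omega>" for Y \<omega>
    using that by (simp add: compatible_comodule_def)
  show ?thesis
  proof (intro conjI ballI allI impI)
    show "nat_trans A A (R \<circ>\<^sub>F L) fid \<epsilon>h" by (rule nat)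
    show "nt_eq A \<epsilon>h (vcomp A \<epsilon>h rl)"
      using inv by (simp add: nt_eq_def vcomp_def rl l r)
    show "nt_eq B (vcomp B lr (L \<rhd> \<epsilon>h \<lhd> R)) (L \<rhd> \<epsilon>h \<lhd> R)"
      using F.lr_counit
      by (simp add: nt_eq_def vcomp_def whisker_left_def whisker_right_def lr l r)
    show "weak_comonad B LR \<delta> \<epsilon>"
      unfolding LR \<delta> by unfold_locales
  next
    fix Y assume "Y \<in> Obj B"
    then show "compatible_comodule_mor B LR \<delta> \<epsilon>
        (FObj LR (FObj LR Y)) (\<delta> (FObj LR Y)) (FObj LR Y) (\<delta> Y) ((L \<rhd> \<epsilon>h \<lhd> R) Y)"
      unfolding LR \<delta> by (rule F.counit_compatible_mor)
  next
    fix Y \<omega> assume "compatible_comodule B LR \<delta> lr Y \<omega>"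
    note c = comod[OF this, unfolded LR \<delta>]
    show mor: "compatible_comodule_mor B LR \<delta> \<epsilon> (FObj LR Y) (\<delta> Y) Y \<omega>
        (frobenius_action B L R \<epsilon> \<epsilon>h Y \<omega>)"
      unfolding LR \<delta> by (rule F.action_compatible_mor[OF c refl])
    show frob: "frobenius_bimodule B L R \<eta> \<epsilon>h Y (frobenius_action B L R \<epsilon> \<epsilon>h Y \<omega>) \<omega>"
      by (rule F.action_frobenius[OF c refl])
    show "\<exists>!\<rho>. compatible_comodule_mor B LR \<delta> \<epsilon> (FObj LR Y) (\<delta> Y) Y \<omega> \<rho> \<and>
        frobenius_bimodule B L R \<eta> \<epsilon>h Y \<rho> \<omega>"
      using mor frob F.action_unique[OF c refl] unfolding LR \<delta> by blast
  next
    fix Y \<omega> Y' \<omega>' h assume "comodule_mor B LR \<delta> Y \<omega> Y' \<omega>' h"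
    then show "frobenius_bimodule_mor B L R \<eta> \<epsilon>h Y (frobenius_action B L R \<epsilon> \<epsilon>h Y \<omega>) \<omega>
        Y' (frobenius_action B L R \<epsilon> \<epsilon>h Y' \<omega>') \<omega>' h"
      unfolding LR \<delta> by (rule F.comodule_mor_frobenius)
  qed
qed

end
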